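(* Let $B$ be a strongly reduced basis of the free group $F_r$. Then no primitivity-blocking word appears as a subword of any element of $B$.
   Context: $F_r$ is the free group of finite rank $r$ with fixed basis $x_1,\dots,x_r$; elements are identified with freely reduced words in $x_i^{\pm1}$, and lengths and subwords (contiguous) refer to these reduced words. A basis of $F_r$ means a free generating set. A basis of $F_r$ is strongly reduced if there is no element $g\in F_r$ such that conjugating each element of the basis by $g$ decreases the sum of the lengths of the basis elements. An element $u\in F_r$ is primitive if some automorphism of $F_r$ takes $x_1$ to $u$. A word $v$ is primitivity-blocking if for every $\varphi\in\operatorname{Aut}(F_r)$, $v$ is not a subword of the cyclic reduction of $\varphi(x_1)$; equivalently, $v$ is not a subword of any cyclically reduced primitive element of $F_r$. *)

theory Defs
  imports "HOL-Algebra.Generated_Groups" "HOL-Library.Sublist"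
begin

text \<open>
  A letter \<open>(True, x)\<close> stands for the generator \<open>x\<close> and \<open>(False, x)\<close> for its inverse.
\<close>

type_synonym 'a letter = "bool \<times> 'a"
type_synonym 'a word = "'a letter list"

definition inv_letter :: "'a letter \<Rightarrow> 'a letter" where
  "inv_letter a = (\<not> fst a, snd a)"

fun reduced :: "'a word \<Rightarrow> bool" where
  "reduced [] = True"
| "reduced [a] = True"
| "reduced (a # b # w) = (b \<noteq> inv_letter a \<and> reduced (b # w))"

fun cancel_cons :: "'a letter \<Rightarrow> 'a word \<Rightarrow> 'a word" where
  "cancel_cons a [] = [a]"
| "cancel_cons a (b # w) = (if b = inv_letter a then w else a # b # w)"

definition free_reduction :: "'a word \<Rightarrow> 'a word" where
  "free_reduction w = foldr cancel_cons w []"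

definition free_group :: "'a set \<Rightarrow> 'a word monoid" where
  "free_group S =
     \<lparr>carrier = {w. reduced w \<and> snd ` set w \<subseteq> S},
      mult = (\<lambda>u v. free_reduction (u @ v)),
      one = []\<rparr>"

definition F :: "nat \<Rightarrow> nat word monoid" where
  "F r = free_group {1..r}"

definition gen :: "nat \<Rightarrow> nat word" where
  "gen i = [(True, i)]"

fun cyclic_reduction :: "'a word \<Rightarrow> 'a word" where
  "cyclic_reduction w =
     (if w \<noteq> [] \<and> hd w = inv_letter (last w) then cyclic_reduction (butlast (tl w)) else w)"

declare cyclic_reduction.simps [simp del]

text \<open>
  The value in \<open>G\<close> of a word whose generators are themselves elements of \<open>G\<close>.
\<close>

definition word_value :: "('b, 'm) monoid_scheme \<Rightarrow> 'b word \<Rightarrow> 'b" where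
  "word_value G w =
     foldr (\<lambda>(s, b) y. (if s then b else inv\<^bsub>G\<^esub> b) \<otimes>\<^bsub>G\<^esub> y) w \<one>\<^bsub>G\<^esub>"

definition free_generating_set :: "('b, 'm) monoid_scheme \<Rightarrow> 'b set \<Rightarrow> bool" where
  "free_generating_set G B \<longleftrightarrow>
     B \<subseteq> carrier G \<and> generate G B = carrier G \<and>
     (\<forall>w. reduced w \<and> w \<noteq> [] \<and> snd ` set w \<subseteq> B \<longrightarrow> word_value G w \<noteq> \<one>\<^bsub>G\<^esub>)"

text \<open>
  Every free generating set of \<open>F r\<close> is finite, so the sums below are genuine; conjugation is
  injective, so they may be indexed by \<open>B\<close> itself.
\<close>

definition strongly_reduced_basis :: "nat \<Rightarrow> nat word set \<Rightarrow> bool" where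
  "strongly_reduced_basis r B \<longleftrightarrow>
     free_generating_set (F r) B \<and>
     \<not> (\<exists>g \<in> carrier (F r).
          (\<Sum>b\<in>B. length (g \<otimes>\<^bsub>F r\<^esub> b \<otimes>\<^bsub>F r\<^esub> inv\<^bsub>F r\<^esub> g)) < (\<Sum>b\<in>B. length b))"

text \<open>
  The word \<open>v\<close> is not required to be an element of \<open>F r\<close>: a word that is not reduced, or that
  uses other letters, is never a subword of an element of \<open>F r\<close>.
\<close>

definition primitivity_blocking :: "nat \<Rightarrow> nat word \<Rightarrow> bool" where
  "primitivity_blocking r v \<longleftrightarrow>
     (\<forall>\<phi> \<in> iso (F r) (F r). \<not> sublist v (cyclic_reduction (\<phi> (gen 1))))"


lemma inv_letter_inv_letter [simp]: "inv_letter (inv_letter a) = a"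
  by (simp add: inv_letter_def)

lemma inv_letter_neq [simp]: "inv_letter a \<noteq> a" "a \<noteq> inv_letter a"
  by (auto simp: inv_letter_def prod_eq_iff)

lemma snd_inv_letter [simp]: "snd (inv_letter a) = snd a"
  by (simp add: inv_letter_def)

lemma reduced_tl: "reduced (a # w) \<Longrightarrow> reduced w"
  by (cases w) auto

lemma reduced_cancel_cons: "reduced w \<Longrightarrow> reduced (cancel_cons a w)"
  by (cases w) (auto dest: reduced_tl)

lemma cancel_cons_inverse: "reduced w \<Longrightarrow> cancel_cons a (cancel_cons (inv_letter a) w) = w"
  by (cases w; cases "tl w") auto

lemma free_reduction_Nil [simp]: "free_reduction [] = []"
  by (simp add: free_reduction_def)

lemma free_reduction_Cons [simp]:
  "free_reduction (a # w) = cancel_cons a (free_reduction w)"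
  by (simp add: free_reduction_def)

lemma reduced_free_reduction [simp]: "reduced (free_reduction w)"
  by (induction w) (auto intro: reduced_cancel_cons)

lemma free_reduction_id: "reduced w \<Longrightarrow> free_reduction w = w"
  by (induction w rule: reduced.induct) auto

lemma set_cancel_cons: "set (cancel_cons a w) \<subseteq> insert a (set w)"
  by (cases w) auto

lemma set_free_reduction: "set (free_reduction w) \<subseteq> set w"
proof (induction w)
  case (Cons a w)
  then show ?case using set_cancel_cons[of a "free_reduction w"] by auto
qed simp

lemma free_reduction_append_right:
  "free_reduction (u @ free_reduction v) = free_reduction (u @ v)"
  by (induction u) (auto simp: free_reduction_id)

lemma free_reduction_cancel_cons_append:
  "free_reduction (cancel_cons a u @ v) = cancel_cons a (free_reduction (u @ v))"
  by (cases u) (auto simp: cancel_cons_inverse)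

lemma free_reduction_append_left:
  "free_reduction (free_reduction u @ v) = free_reduction (u @ v)"
  by (induction u) (auto simp: free_reduction_cancel_cons_append)

lemma free_reduction_inverse: "free_reduction (rev (map inv_letter w) @ w) = []"
proof (induction w)
  case (Cons a w)
  have "free_reduction (rev (map inv_letter (a # w)) @ a # w)
      = free_reduction (rev (map inv_letter w) @ free_reduction (inv_letter a # a # w))"
    unfolding free_reduction_append_right by simp
  also have "free_reduction (inv_letter a # a # w) = free_reduction w"
    using cancel_cons_inverse[of "free_reduction w" "inv_letter a"] by simp
  finally show ?case using Cons by (simp add: free_reduction_append_right)
qed simp

lemma group_free_group: "group (free_group S)"
proof (rule groupI)
  fix u v assume "u \<in> carrier (free_group S)" "v \<in> carrier (free_group S)"
  then show "u \<otimes>\<^bsub>free_group S\<^esub> v \<in> carrier (free_group S)"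
    using set_free_reduction[of "u @ v"] by (fastforce simp: free_group_def)
next
  fix u assume u: "u \<in> carrier (free_group S)"
  let ?v = "free_reduction (rev (map inv_letter u))"
  have "?v \<in> carrier (free_group S)"
    using u set_free_reduction[of "rev (map inv_letter u)"] by (fastforce simp: free_group_def)
  moreover have "?v \<otimes>\<^bsub>free_group S\<^esub> u = \<one>\<^bsub>free_group S\<^esub>"
    by (simp add: free_group_def free_reduction_append_left free_reduction_inverse)
  ultimately show "\<exists>v\<in>carrier (free_group S). v \<otimes>\<^bsub>free_group S\<^esub> u = \<one>\<^bsub>free_group S\<^esub>"
    by blast
qed (auto simp: free_group_def free_reduction_append_left free_reduction_append_right
      free_reduction_id)

lemma group_F: "group (F r)"
  by (simp add: F_def group_free_group)

end

theory Submission
  imports Defs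
begin

text \<open>
  If \<open>b \<in> B\<close> is cyclically reduced, it is itself a cyclically reduced primitive element. Otherwise
  \<open>b\<close> starts with some letter \<open>x\<close> and ends with its inverse. Conjugation by the inverse of \<open>x\<close>
  shortens \<open>b\<close>, so strong reducedness forces some \<open>c \<in> B\<close> to get longer, that is, \<open>c\<close> neither
  starts with \<open>x\<close> nor ends with the inverse of \<open>x\<close>. Then \<open>b @ c\<close> is a cyclically reduced word, and
  it is primitive because replacing \<open>b\<close> by the product of \<open>b\<close> and \<open>c\<close> in \<open>B\<close> gives a basis again.

  Primitivity in the sense of automorphisms needs that every basis of \<open>F r\<close> has exactly \<open>r\<close> elements;
  this follows by comparing the homomorphisms to the group of order two.
\<close>

section \<open>Reduced words and free reduction\<close>

lemma carrier_free_group [simp]: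
  "w \<in> carrier (free_group S) \<longleftrightarrow> reduced w \<and> snd ` set w \<subseteq> S"
  by (simp add: free_group_def)

lemma mult_free_group [simp]: "u \<otimes>\<^bsub>free_group S\<^esub> v = free_reduction (u @ v)"
  by (simp add: free_group_def)

lemma one_free_group [simp]: "\<one>\<^bsub>free_group S\<^esub> = []"
  by (simp add: free_group_def)

lemma inv_singleton_free_group:
  assumes "snd a \<in> S"
  shows "inv\<^bsub>free_group S\<^esub> [a] = [inv_letter a]"
  by (rule group.inv_equality[OF group_free_group]) (use assms in auto)

lemma reduced_append:
  "reduced (u @ v) \<longleftrightarrow>
     reduced u \<and> reduced v \<and> (u \<noteq> [] \<and> v \<noteq> [] \<longrightarrow> hd v \<noteq> inv_letter (last u))"
proof (induction u rule: reduced.induct)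
  case (2 a)
  then show ?case by (cases v) auto
qed auto

text \<open>Renaming keeps exponents, and injectivity on \<open>S\<close> prevents distinct
  generators from being identified, so no new cancelling pair can arise.\<close>

lemma reduced_map_apsnd:
  assumes "inj_on f S" "snd ` set w \<subseteq> S" "reduced w"
  shows "reduced (map (apsnd f) w)"
  using assms(2,3)
proof (induction w rule: reduced.induct)
  case (3 a b w)
  have "apsnd f b \<noteq> inv_letter (apsnd f a)"
    using 3(2,3) assms(1) by (auto simp: inv_letter_def prod_eq_iff inj_on_def)
  then show ?case using 3 by simp
qed auto

lemma length_cancel_cons: "length (cancel_cons a w) \<le> Suc (length w)"
  by (cases w) auto

lemma length_free_reduction: "length (free_reduction w) \<le> length w"
proof (induction w)
  case (Cons a w)
  then show ?case using length_cancel_cons[of a "free_reduction w"] by simp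
qed simp

lemma free_reduction_inv_letter_Cons:
  "free_reduction (inv_letter a # a # w) = free_reduction w"
  using cancel_cons_inverse[of "free_reduction w" "inv_letter a"] by simp

lemma free_reduction_snoc_inv_letter:
  "free_reduction (w @ [inv_letter a, a]) = free_reduction w"
  using free_reduction_append_right[of w "[inv_letter a, a]"] by simp


subsection \<open>The universal property\<close>

lemma word_value_Nil [simp]: "word_value G [] = \<one>\<^bsub>G\<^esub>"
  by (simp add: word_value_def)

lemma word_value_Cons:
  "word_value G (a # w) = (if fst a then snd a else inv\<^bsub>G\<^esub> snd a) \<otimes>\<^bsub>G\<^esub> word_value G w"
  by (simp add: word_value_def split_beta)

text \<open>The homomorphism extending \<open>f\<close>. Renaming the letters to elements of the
  target before evaluating makes the freeness clause of \<open>free_generating_set\<close> directly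
  applicable.\<close>

definition free_lift :: "('b, 'm) monoid_scheme \<Rightarrow> ('a \<Rightarrow> 'b) \<Rightarrow> 'a word \<Rightarrow> 'b" where
  "free_lift G f w = word_value G (map (apsnd f) w)"

context group
begin

lemma word_value_closed: "snd ` set w \<subseteq> carrier G \<Longrightarrow> word_value G w \<in> carrier G"
  by (induction w) (auto simp: word_value_Cons)

lemma word_value_append:
  "snd ` set u \<subseteq> carrier G \<Longrightarrow> snd ` set v \<subseteq> carrier G \<Longrightarrow>
     word_value G (u @ v) = word_value G u \<otimes> word_value G v"
  by (induction u) (auto simp: word_value_Cons word_value_closed m_assoc)

lemma free_lift_singleton:
  "f s \<in> carrier G \<Longrightarrow> free_lift G f [(True, s)] = f s"
  by (simp add: free_lift_def word_value_Cons)

text \<open>A deleted pair of letters contributes an element times its inverse, so evaluation does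
  not see the cancellation.\<close>

lemma free_lift_cancel_cons:
  assumes "f ` snd ` set (a # w) \<subseteq> carrier G"
  shows "free_lift G f (cancel_cons a w) = free_lift G f (a # w)"
  using assms
  by (cases w)
    (auto simp: free_lift_def word_value_Cons inv_letter_def image_image word_value_closed
      m_assoc[symmetric])

lemma free_lift_free_reduction:
  "f ` snd ` set w \<subseteq> carrier G \<Longrightarrow> free_lift G f (free_reduction w) = free_lift G f w"
proof (induction w)
  case (Cons a w)
  have "f ` snd ` set (a # free_reduction w) \<subseteq> carrier G"
    using Cons.prems set_free_reduction[of w] by auto
  then show ?case using Cons free_lift_cancel_cons[of f a "free_reduction w"]
    by (simp add: free_lift_def word_value_Cons)
qed simp

lemma free_lift_hom:
  assumes "f ` S \<subseteq> carrier G"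
  shows "free_lift G f \<in> hom (free_group S) G"
proof (rule homI)
  have closed: "snd ` set (map (apsnd f) w) \<subseteq> carrier G" if "snd ` set w \<subseteq> S" for w
    using assms that by (fastforce simp: image_image)
  fix u assume u: "u \<in> carrier (free_group S)"
  then show "free_lift G f u \<in> carrier G"
    unfolding free_lift_def by (intro word_value_closed closed) simp
  fix v assume v: "v \<in> carrier (free_group S)"
  have "snd ` set (u @ v) \<subseteq> S"
    using u v by auto
  then have "f ` snd ` set (u @ v) \<subseteq> carrier G"
    using assms by blast
  then have "free_lift G f (free_reduction (u @ v)) = free_lift G f (u @ v)"
    by (rule free_lift_free_reduction)
  also have "\<dots> = free_lift G f u \<otimes> free_lift G f v"
    using u v unfolding free_lift_def map_append
    by (intro word_value_append closed) simp_all
  finally show "free_lift G f (u \<otimes>\<^bsub>free_group S\<^esub> v) = free_lift G f u \<otimes> free_lift G f v"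
    by simp
qed

text \<open>This is the uniqueness half of the universal property: a homomorphism is determined
  letter by letter, inverse letters going to inverses.\<close>

lemma hom_free_group_eq_lift:
  assumes h: "h \<in> hom (free_group S) G" and "w \<in> carrier (free_group S)"
  shows "h w = free_lift G (\<lambda>s. h [(True, s)]) w"
  using assms(2)
proof (induction w)
  case Nil
  interpret h: group_hom "free_group S" G h
    by (intro group_hom.intro group_hom_axioms.intro group_free_group group_axioms h)
  show ?case using h.hom_one by (simp add: free_lift_def)
next
  case (Cons a w)
  interpret h: group_hom "free_group S" G h
    by (intro group_hom.intro group_hom_axioms.intro group_free_group group_axioms h)
  obtain s x where a: "a = (s, x)" by (cases a)
  have x: "x \<in> S" and w: "w \<in> carrier (free_group S)"
    using Cons.prems by (auto simp: a dest: reduced_tl)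
  have "h [a] = (if s then h [(True, x)] else inv h [(True, x)])"
    using h.hom_inv[of "[(True, x)]"] inv_singleton_free_group[of "(True, x)" S] x
    by (simp add: a inv_letter_def)
  moreover have "h (a # w) = h [a] \<otimes> h w"
    using h.hom_mult[of "[a]" w] w x Cons.prems
    by (simp add: free_reduction_id a del: free_reduction_Cons)
  ultimately show ?case
    using Cons.IH[OF w] by (simp add: a free_lift_def word_value_Cons)
qed

lemma hom_free_group_eqI:
  assumes "h \<in> hom (free_group S) G" "k \<in> hom (free_group S) G"
    and "\<And>s. s \<in> S \<Longrightarrow> h [(True, s)] = k [(True, s)]" and "w \<in> carrier (free_group S)"
  shows "h w = k w"
proof -
  have "map (apsnd (\<lambda>s. h [(True, s)])) w = map (apsnd (\<lambda>s. k [(True, s)])) w"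
    using assms(3,4) by (auto simp: apsnd_def map_prod_def split_beta)
  then show ?thesis
    using hom_free_group_eq_lift[OF assms(1,4)] hom_free_group_eq_lift[OF assms(2,4)]
    by (simp only: free_lift_def)
qed

text \<open>Generation by \<open>B\<close> gives surjectivity, and the absence of relations among
  elements of \<open>B\<close> gives a trivial kernel.\<close>

lemma free_lift_iso:
  assumes B: "free_generating_set G B" and f: "bij_betw f S B"
  shows "free_lift G f \<in> iso (free_group S) G"
proof -
  have B': "B \<subseteq> carrier G" "generate G B = carrier G"
    and free: "\<And>w. reduced w \<Longrightarrow> w \<noteq> [] \<Longrightarrow> snd ` set w \<subseteq> B \<Longrightarrow> word_value G w \<noteq> \<one>"
    using B by (auto simp: free_generating_set_def)
  have fS: "f ` S = B" "inj_on f S" using f by (auto simp: bij_betw_def)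
  have hom: "free_lift G f \<in> hom (free_group S) G"
    using B' fS by (intro free_lift_hom) simp
  interpret h: group_hom "free_group S" G "free_lift G f"
    by (intro group_hom.intro group_hom_axioms.intro group_free_group group_axioms hom)
  have "B \<subseteq> free_lift G f ` carrier (free_group S)"
  proof
    fix b assume "b \<in> B"
    then obtain s where "s \<in> S" "b = f s" using fS by blast
    then have "b = free_lift G f [(True, s)]"
      using B' fS by (auto simp: free_lift_singleton)
    moreover have "[(True, s)] \<in> carrier (free_group S)" using \<open>s \<in> S\<close> by simp
    ultimately show "b \<in> free_lift G f ` carrier (free_group S)" by blast
  qed
  then have "carrier G \<subseteq> free_lift G f ` carrier (free_group S)"
    using generate_subgroup_incl[OF _ h.img_is_subgroup, of B] B' by simp
  then have surj: "free_lift G f ` carrier (free_group S) = carrier G"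
    using h.hom_closed by blast
  have "w = []" if "w \<in> carrier (free_group S)" "free_lift G f w = \<one>" for w
  proof (rule ccontr)
    \<comment> \<open>The renamed kernel element would be a nonempty reduced word over
      \<open>B\<close> with value \<open>\<one>\<close>.\<close>
    assume "w \<noteq> []"
    moreover have "reduced (map (apsnd f) w)"
      using reduced_map_apsnd fS that by auto
    moreover have "snd ` set (map (apsnd f) w) \<subseteq> B"
      using that fS by auto
    ultimately show False using free that by (auto simp: free_lift_def)
  qed
  then have "inj_on (free_lift G f) (carrier (free_group S))"
    by (subst h.inj_on_one_iff) auto
  then show ?thesis using hom surj by (simp add: iso_def bij_betw_def)
qed

end


subsection \<open>The rank of a free group\<close>

text \<open>The homomorphism to the group of order two that is nontrivial exactly on the generators
  in \<open>C\<close>; \<open>True\<close> is the nontrivial element and \<open>\<noteq>\<close> on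
  truth values is the product.\<close>

definition letter_parity :: "'a set \<Rightarrow> 'a word \<Rightarrow> bool" where
  "letter_parity C w \<longleftrightarrow> odd (length (filter (\<lambda>a. snd a \<in> C) w))"

lemma letter_parity_append: "letter_parity C (u @ v) \<longleftrightarrow> letter_parity C u \<noteq> letter_parity C v"
  by (auto simp: letter_parity_def)

lemma letter_parity_cancel_cons: "letter_parity C (cancel_cons a w) = letter_parity C (a # w)"
  by (cases w) (auto simp: letter_parity_def)

lemma letter_parity_free_reduction: "letter_parity C (free_reduction w) = letter_parity C w"
proof (induction w)
  case (Cons a w)
  then show ?case
    using letter_parity_append[of C "[a]" w] letter_parity_append[of C "[a]" "free_reduction w"]
    by (simp add: letter_parity_cancel_cons)
qed simp

text \<open>Parity composed with \<open>\<psi>\<close> is a homomorphism to the group of order two,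
  hence determined by its values on generators.\<close>

lemma letter_parity_hom_eqI:
  assumes \<psi>: "\<psi> \<in> hom (free_group T) (free_group S)"
    and eq: "\<And>t. t \<in> T \<Longrightarrow> letter_parity C (\<psi> [(True, t)]) = letter_parity D (\<psi> [(True, t)])"
    and "w \<in> carrier (free_group T)"
  shows "letter_parity C (\<psi> w) = letter_parity D (\<psi> w)"
  using assms(3)
proof (induction w)
  case Nil
  have "\<psi> [] = []"
    using hom_one[OF \<psi> group_free_group group_free_group] by simp
  then show ?case by (simp add: letter_parity_def)
next
  case (Cons a w)
  have mult: "letter_parity E (\<psi> (free_reduction (u @ v))) =
      (letter_parity E (\<psi> u) \<noteq> letter_parity E (\<psi> v))"
    if "u \<in> carrier (free_group T)" "v \<in> carrier (free_group T)" for E u v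
    using hom_mult[OF \<psi> that] by (simp add: letter_parity_free_reduction letter_parity_append)
  have "\<psi> [] = []"
    using hom_one[OF \<psi> group_free_group group_free_group] by simp
  \<comment> \<open>In the group of order two an element equals its inverse, so only the positive
    letter has to be compared.\<close>
  then have "letter_parity E (\<psi> [a]) = letter_parity E (\<psi> [inv_letter a])" for E
    using mult[of "[a]" "[inv_letter a]" E] Cons.prems by (simp add: letter_parity_def)
  moreover have "(True, snd a) = a \<or> (True, snd a) = inv_letter a"
    by (cases a) (auto simp: inv_letter_def)
  ultimately have "letter_parity C (\<psi> [a]) = letter_parity D (\<psi> [a])"
    using eq[of "snd a"] Cons.prems by auto
  moreover have "w \<in> carrier (free_group T)"
    using Cons.prems by (auto dest: reduced_tl)
  moreover from this have "letter_parity E (\<psi> (a # w)) =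
      (letter_parity E (\<psi> [a]) \<noteq> letter_parity E (\<psi> w))" for E
    using mult[of "[a]" w E] Cons.prems
    by (simp add: free_reduction_id del: free_reduction_Cons)
  ultimately show ?case using Cons.IH by blast
qed

text \<open>Homomorphisms from a free group to the group of order two correspond to sets of
  generators. Composition with a surjection is injective on them, whence
  \<open>2 ^ card S \<le> 2 ^ card T\<close>.\<close>

lemma free_group_epi_card_le:
  assumes \<psi>: "\<psi> \<in> hom (free_group T) (free_group S)"
    and surj: "carrier (free_group S) \<subseteq> \<psi> ` carrier (free_group T)" and T: "finite T"
  shows "finite S \<and> card S \<le> card T"
proof -
  \<comment> \<open>\<open>P C\<close> is the set of generators in \<open>T\<close> on which the
    pullback of the parity of \<open>C\<close> along \<open>\<psi>\<close> is nontrivial.\<close>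
  define P where "P C = {t \<in> T. letter_parity C (\<psi> [(True, t)])}" for C
  have inj: "inj_on P (Pow S)"
  proof (rule inj_onI)
    fix C D assume CD: "C \<in> Pow S" "D \<in> Pow S" and "P C = P D"
    then have eq: "letter_parity C (\<psi> [(True, t)]) = letter_parity D (\<psi> [(True, t)])"
      if "t \<in> T" for t using that by (auto simp: P_def)
    have "s \<in> C \<longleftrightarrow> s \<in> D" if "s \<in> S" for s
    proof -
      have "[(True, s)] \<in> carrier (free_group S)" using that by simp
      then obtain w where "w \<in> carrier (free_group T)" "[(True, s)] = \<psi> w"
        using surj by blast
      then have "letter_parity C [(True, s)] = letter_parity D [(True, s)]"
        using letter_parity_hom_eqI[OF \<psi> eq] by simp
      then show ?thesis by (simp add: letter_parity_def split: if_splits)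
    qed
    then show "C = D" using CD by blast
  qed
  have sub: "P ` Pow S \<subseteq> Pow T" by (auto simp: P_def)
  then have "finite (Pow S)"
    using inj T by (meson finite_Pow_iff finite_imageD finite_subset)
  then have "finite S" by simp
  moreover have "card (Pow S) \<le> card (Pow T)"
    using card_inj_on_le[OF inj sub] T by simp
  ultimately show ?thesis using T by (simp add: card_Pow)
qed

lemma free_generating_set_free_group_card:
  assumes B: "free_generating_set (free_group S) B" and S: "finite S"
  shows "finite B \<and> card B = card S"
proof -
  interpret group "free_group S" by (rule group_free_group)
  \<comment> \<open>Here the elements of \<open>B\<close> serve as the letters of an abstract free
    group; the isomorphism and its inverse give the two inequalities.\<close>
  have iso: "free_lift (free_group S) id \<in> iso (free_group B) (free_group S)"
    by (rule free_lift_iso[OF B]) simp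
  let ?g = "inv_into (carrier (free_group B)) (free_lift (free_group S) id)"
  have "?g \<in> iso (free_group S) (free_group B)"
    using group.iso_set_sym[OF group_free_group iso] .
  then have "finite B \<and> card B \<le> card S"
    using free_group_epi_card_le[of ?g S B] S by (auto simp: iso_def bij_betw_def)
  moreover from this have "card S \<le> card B"
    using free_group_epi_card_le[of "free_lift (free_group S) id" B S] iso
    by (auto simp: iso_def bij_betw_def)
  ultimately show ?thesis by simp
qed


subsection \<open>Primitive elements\<close>

lemma transvection_iso:
  fixes x y :: 'a
  assumes xy: "x \<in> S" "y \<in> S" "x \<noteq> y"
  shows "\<exists>\<tau> \<in> iso (free_group S) (free_group S). \<tau> [(True, x)] = [(True, x), (True, y)]"
proof -
  interpret group "free_group S" by (rule group_free_group)
  \<comment> \<open>The flag \<open>e\<close> is the exponent of \<open>y\<close>: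
    \<open>True\<close> gives the transvection and \<open>False\<close> its inverse.\<close>
  define f where "f e s = (if s = x then [(True, x), (e, y)] else [(True, s)])" for e and s :: 'a
  let ?\<tau> = "\<lambda>e. free_lift (free_group S) (f e)"
  have f: "f e s \<in> carrier (free_group S)" if "s \<in> S" for e s
    using xy that by (simp add: f_def inv_letter_def)
  then have hom: "?\<tau> e \<in> hom (free_group S) (free_group S)" for e
    by (intro free_lift_hom) blast
  have gen: "?\<tau> e [(True, s)] = f e s" if "s \<in> S" for e s
    using f that by (intro free_lift_singleton)
  have inverse: "?\<tau> (\<not> e) (?\<tau> e w) = w" if "w \<in> carrier (free_group S)" for e w
  proof -
    \<comment> \<open>Both sides are homomorphisms, so agreement on generators suffices.\<close>
    have "(?\<tau> (\<not> e) \<circ> ?\<tau> e) w = (\<lambda>w. w) w"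
    proof (rule hom_free_group_eqI[OF _ _ _ that])
      show "?\<tau> (\<not> e) \<circ> ?\<tau> e \<in> hom (free_group S) (free_group S)"
        using hom Group.hom_compose by blast
      show "(\<lambda>w. w) \<in> hom (free_group S) (free_group S)" by (simp add: hom_def)
      fix s assume s: "s \<in> S"
      show "(?\<tau> (\<not> e) \<circ> ?\<tau> e) [(True, s)] = [(True, s)]"
        using xy s
        by (cases e) (auto simp: gen, auto simp: f_def free_lift_def word_value_Cons
            inv_singleton_free_group inv_letter_def)
    qed
    then show ?thesis by simp
  qed
  have closed: "?\<tau> e ` carrier (free_group S) \<subseteq> carrier (free_group S)" for e
    using hom_in_carrier[OF hom] by blast
  have "bij_betw (?\<tau> True) (carrier (free_group S)) (carrier (free_group S))"
    using inverse[of _ True] inverse[of _ False] closed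
    by (intro bij_betw_byWitness[where f' = "?\<tau> False"]) auto
  then have "?\<tau> True \<in> iso (free_group S) (free_group S)"
    using hom by (simp add: iso_def)
  then show ?thesis
    using gen[of x True] xy by (intro bexI[of _ "?\<tau> True"]) (simp_all add: f_def)
qed

lemma ex_bij_betw_pointed:
  assumes "finite A" "finite B" "card A = card B" "a \<in> A" "b \<in> B"
  shows "\<exists>f. bij_betw f A B \<and> f a = b"
proof -
  obtain g where g: "bij_betw g (A - {a}) (B - {b})"
    using finite_same_card_bij[of "A - {a}" "B - {b}"] assms by auto
  have "bij_betw (g(a := b)) (A - {a}) (B - {b})"
    using g by (subst bij_betw_cong[where g = g]) auto
  then have "bij_betw (g(a := b)) (insert a (A - {a})) (insert b (B - {b}))"
    using notIn_Un_bij_betw[of a "A - {a}" "g(a := b)" "B - {b}"] by simp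
  then show ?thesis
    using assms by (intro exI[of _ "g(a := b)"]) (simp add: insert_absorb)
qed

context
  fixes r :: nat and B :: "nat word set" and b :: "nat word"
  assumes basis: "free_generating_set (F r) B" and b: "b \<in> B"
begin

lemma rank_card: "finite B \<and> card B = r"
  using free_generating_set_free_group_card[of "{1..r}" B] basis by (auto simp: F_def)

text \<open>Since \<open>B\<close> has \<open>r\<close> elements, it can be enumerated by
  \<open>{1..r}\<close> with \<open>b\<close> in first place; lifting the enumeration gives the
  automorphism.\<close>

lemma ex_automorphism_to_basis:
  "\<exists>f. bij_betw f {1..r} B \<and> f 1 = b \<and> free_lift (F r) f \<in> iso (F r) (F r) \<and>
     (\<forall>i \<in> {1..r}. free_lift (F r) f [(True, i)] = f i)"
proof -
  interpret group "F r" by (rule group_F)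
  have "1 \<in> {1..r}"
    using rank_card b card_gt_0_iff[of B] by auto
  then obtain f where f: "bij_betw f {1..r} B" "f 1 = b"
    using ex_bij_betw_pointed[of "{1..r}" B 1 b] rank_card b by auto
  have "f i \<in> carrier (F r)" if "i \<in> {1..r}" for i
    using f(1) basis that by (auto simp: bij_betw_def free_generating_set_def)
  then have "\<forall>i \<in> {1..r}. free_lift (F r) f [(True, i)] = f i"
    by (simp add: free_lift_singleton)
  moreover have "free_lift (F r) f \<in> iso (F r) (F r)"
    using free_lift_iso[OF basis f(1)] by (simp add: F_def)
  ultimately show ?thesis using f by blast
qed

lemma basis_element_primitive: "\<exists>\<phi> \<in> iso (F r) (F r). \<phi> (gen 1) = b"
proof -
  have "1 \<in> {1..r}"
    using rank_card b card_gt_0_iff[of B] by auto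
  then show ?thesis using ex_automorphism_to_basis unfolding gen_def by metis
qed

text \<open>First apply the transvection multiplying the first generator by the \<open>i\<close>-th,
  then the automorphism carrying these two generators to \<open>b\<close> and
  \<open>c\<close>.\<close>

lemma basis_product_primitive:
  assumes c: "c \<in> B" "c \<noteq> b"
  shows "\<exists>\<phi> \<in> iso (F r) (F r). \<phi> (gen 1) = b \<otimes>\<^bsub>F r\<^esub> c"
proof -
  obtain f where f: "bij_betw f {1..r} B" "f 1 = b"
    and iso: "free_lift (F r) f \<in> iso (F r) (F r)"
    and gen: "\<And>i. i \<in> {1..r} \<Longrightarrow> free_lift (F r) f [(True, i)] = f i"
    using ex_automorphism_to_basis by blast
  obtain i where i: "i \<in> {1..r}" "f i = c"
    using f(1) c by (auto simp: bij_betw_def)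
  have one: "1 \<in> {1..r}" "1 \<noteq> i" using i f c by auto
  obtain \<tau> where \<tau>: "\<tau> \<in> iso (F r) (F r)" "\<tau> (gen 1) = [(True, 1), (True, i)]"
    using transvection_iso[OF one(1) i(1) one(2)] by (auto simp: F_def gen_def)
  have hom: "free_lift (F r) f \<in> hom (F r) (F r)"
    using iso by (simp add: iso_def)
  have carrier: "[(True, 1)] \<in> carrier (F r)" "[(True, i)] \<in> carrier (F r)"
    using one i by (simp_all add: F_def)
  have "\<tau> (gen 1) = [(True, 1)] \<otimes>\<^bsub>F r\<^esub> [(True, i)]"
    using \<tau>(2) by (simp add: F_def inv_letter_def)
  then have "free_lift (F r) f (\<tau> (gen 1)) = b \<otimes>\<^bsub>F r\<^esub> c"
    by (simp only: hom_mult[OF hom carrier] gen[OF one(1)] gen[OF i(1)] i(2) f(2))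
  then show ?thesis
    using iso_set_trans[OF \<tau>(1) iso] by (intro bexI[of _ "free_lift (F r) f \<circ> \<tau>"]) simp_all
qed

end


subsection \<open>Conjugation by a letter\<close>

text \<open>Conjugation adds two letters, and a matching letter at either end of \<open>c\<close>
  cancels at least two.\<close>

lemma length_conj_le:
  assumes "(c \<noteq> [] \<and> hd c = x) \<or> (c \<noteq> [] \<and> last c = inv_letter x)"
  shows "length (free_reduction (inv_letter x # c @ [x])) \<le> length c"
  using assms
proof
  assume "c \<noteq> [] \<and> hd c = x"
  then obtain d where "c = x # d" by (cases c) auto
  then show ?thesis
    using free_reduction_inv_letter_Cons[of x "d @ [x]"] length_free_reduction[of "d @ [x]"]
    by simp
next
  assume "c \<noteq> [] \<and> last c = inv_letter x"
  then obtain d where "c = d @ [inv_letter x]" by (cases c rule: rev_cases) auto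
  then show ?thesis
    using free_reduction_snoc_inv_letter[of "inv_letter x # d" x]
      length_free_reduction[of "inv_letter x # d"]
    by simp
qed

text \<open>Both added letters cancel against the ends, leaving a word no longer than
  \<open>d\<close>.\<close>

lemma length_conj_less:
  "length (free_reduction (inv_letter x # (x # d @ [inv_letter x]) @ [x])) <
     length (x # d @ [inv_letter x])"
  using free_reduction_inv_letter_Cons[of x "d @ [inv_letter x, x]"]
    free_reduction_snoc_inv_letter[of d x] length_free_reduction[of d]
  by simp

text \<open>If every basis element shared an end with \<open>b\<close>, conjugation by the inverse
  of the first letter of \<open>b\<close> would lengthen none of them and shorten
  \<open>b\<close>.\<close>

lemma strongly_reduced_basis_ex_lengthened:
  assumes B: "strongly_reduced_basis r B"
    and b: "b \<in> B" "b \<noteq> []" "hd b = inv_letter (last b)"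
  shows "\<exists>c \<in> B. c \<noteq> [] \<longrightarrow> hd c \<noteq> hd b \<and> last c \<noteq> last b"
proof (rule ccontr)
  assume "\<not> ?thesis"
  then have ends: "c \<noteq> [] \<and> (hd c = hd b \<or> last c = last b)" if "c \<in> B" for c
    using that by blast
  define x where "x = hd b"
  have basis: "free_generating_set (F r) B"
    using B by (simp add: strongly_reduced_basis_def)
  then have BF: "B \<subseteq> carrier (F r)" by (simp add: free_generating_set_def)
  have lb: "last b = inv_letter x" using b by (simp add: x_def)
  obtain t where t: "b = x # t" using b x_def by (cases b) auto
  \<comment> \<open>A single letter would be both first and last, hence its own inverse.\<close>
  moreover have "t \<noteq> []" using t lb by auto
  ultimately obtain d where d: "b = x # d @ [inv_letter x]"
    using lb by (cases t rule: rev_cases) auto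
  have x: "snd x \<in> {1..r}" using BF b t by (auto simp: F_def)
  have "inv\<^bsub>F r\<^esub> [inv_letter x] = [x]"
    using inv_singleton_free_group[of "inv_letter x" "{1..r}"] x by (simp add: F_def)
  then have conj: "[inv_letter x] \<otimes>\<^bsub>F r\<^esub> c \<otimes>\<^bsub>F r\<^esub> inv\<^bsub>F r\<^esub> [inv_letter x] =
      free_reduction (inv_letter x # c @ [x])" for c
    using free_reduction_append_left[of "inv_letter x # c" "[x]"] by (simp add: F_def)
  have "(\<Sum>c\<in>B. length (free_reduction (inv_letter x # c @ [x]))) < (\<Sum>c\<in>B. length c)"
  proof (rule sum_strict_mono_ex1)
    show "finite B" using rank_card[OF basis] b by blast
    show "\<forall>c\<in>B. length (free_reduction (inv_letter x # c @ [x])) \<le> length c"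
      using ends lb BF x_def by (intro ballI length_conj_le) (auto simp: F_def)
    show "\<exists>c\<in>B. length (free_reduction (inv_letter x # c @ [x])) < length c"
      using b(1) length_conj_less d by metis
  qed
  moreover have "[inv_letter x] \<in> carrier (F r)" using x by (simp add: F_def)
  ultimately show False
    using B unfolding strongly_reduced_basis_def conj[symmetric] by blast
qed

text \<open>The one-letter word over the identity would be a nontrivial relation.\<close>

lemma free_generating_set_not_Nil:
  assumes "free_generating_set (F r) B"
  shows "[] \<notin> B"
proof
  interpret group "F r" by (rule group_F)
  assume "[] \<in> B"
  then have "word_value (F r) [(True, [])] \<noteq> \<one>\<^bsub>F r\<^esub>"
    using assms by (simp add: free_generating_set_def)
  moreover have "\<one>\<^bsub>F r\<^esub> = []" by (simp add: F_def)
  ultimately show False using l_one[of "[]"] one_closed by (simp add: word_value_Cons)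
qed

lemma cyclic_reduction_id: "w = [] \<or> hd w \<noteq> inv_letter (last w) \<Longrightarrow> cyclic_reduction w = w"
  by (subst cyclic_reduction.simps) auto

theorem lemma3p2:
  fixes r :: nat and B :: "nat word set"
  assumes "strongly_reduced_basis r B"
  shows "\<not> (\<exists>v. primitivity_blocking r v \<and> (\<exists>b\<in>B. sublist v b))"
proof
  assume "\<exists>v. primitivity_blocking r v \<and> (\<exists>b\<in>B. sublist v b)"
  then obtain v b where v: "primitivity_blocking r v" and b: "b \<in> B" "sublist v b"
    by blast
  have basis: "free_generating_set (F r) B"
    using assms by (simp add: strongly_reduced_basis_def)
  have not_Nil: "c \<noteq> []" and reduced: "reduced c" if "c \<in> B" for c
    using basis that free_generating_set_not_Nil[OF basis]
    by (auto simp: free_generating_set_def F_def)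
  show False
  proof (cases "hd b = inv_letter (last b)")
    case False
    then have "cyclic_reduction b = b" by (simp add: cyclic_reduction_id)
    then show False
      using basis_element_primitive[OF basis b(1)] v b(2)
      unfolding primitivity_blocking_def by metis
  next
    case True
    then obtain c where c: "c \<in> B" "hd c \<noteq> hd b" "last c \<noteq> last b"
      using strongly_reduced_basis_ex_lengthened[OF assms b(1)] not_Nil b(1) by blast
    \<comment> \<open>The first inequality prevents cancellation where \<open>b\<close> meets
      \<open>c\<close>, the second prevents cyclic cancellation in \<open>b @ c\<close>.\<close>
    have "hd c \<noteq> inv_letter (last b)" "hd b \<noteq> inv_letter (last c)"
      using c True by (auto dest: arg_cong[of _ _ inv_letter])
    then have "b \<otimes>\<^bsub>F r\<^esub> c = b @ c" and "cyclic_reduction (b @ c) = b @ c"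
      using reduced not_Nil b(1) c(1)
      by (simp_all add: F_def free_reduction_id reduced_append cyclic_reduction_id)
    moreover have "sublist v (b @ c)"
      using b(2) by (auto simp: sublist_append)
    \<comment> \<open>Different first letters give \<open>c \<noteq> b\<close>, as the transvection
      requires.\<close>
    ultimately show False
      using basis_product_primitive[OF basis b(1) c(1)] c(2) v
      unfolding primitivity_blocking_def by metis
  qed
qed

end
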